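(* Let $(X,d)$ be a nonempty compact metric space and let $T:X\to X$ be continuous. Then: (1) if $h_{pre}(T)<+\infty$, then $D_{pre}(T)\le 1$; (2) if $h_{pre}(T)=+\infty$, then $D_{pre}(T)\ge 1$; (3) if $0<h_{pre}(T)<+\infty$, then $D_{pre}(T)=1$.
   Context: For $n\in\mathbb{N}=\{1,2,\dots\}$ put $d_{T,n}(x,y)=\max_{0\le j<n}d(T^j(x),T^j(y))$. For $K\subseteq X$ and $\epsilon>0$, a set $E\subseteq K$ is an $(n,\epsilon,K,T)$-separated set if $d_{T,n}(x,y)>\epsilon$ for all $x\ne y$ in $E$; $r(n,\epsilon,K,T)$ denotes the maximal cardinality of an $(n,\epsilon,K,T)$-separated subset of $K$. Here $T^{-k}(x)=\{y\in X: T^k(y)=x\}$. The preimage entropy of $T$ is $$h_{pre}(T)=\lim_{\epsilon\to 0}\limsup_{n\to\infty}\frac{1}{n}\log\sup_{x\in X,\,k\ge n}r(n,\epsilon,T^{-k}(x),T).$$ For real $s>0$, the $s$-preimage entropy of $T$ is $$D_{pre}(s,T)=\lim_{\epsilon\to 0}\limsup_{n\to\infty}\frac{1}{n^s}\log\sup_{x\in X,\,k\ge n}r(n,\epsilon,T^{-k}(x),T)\in[0,+\infty],$$ and the preimage entropy dimension of $T$ is $$D_{pre}(T)=\inf\{s>0: D_{pre}(s,T)=0\}=\sup\{s>0: D_{pre}(s,T)=\infty\}\in[0,+\infty]$$ (with $\inf\emptyset=+\infty$ and $\sup\emptyset=0$). *)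

theory Defs
  imports "HOL-Analysis.Analysis"
begin

text \<open>
  A compact metric space is given as a compact subset \<open>X\<close> of a type of class \<open>metric_space\<close>, and a
  self-map of it as a function \<open>T\<close> with \<open>T \<in> X \<rightarrow> X\<close>.
\<close>

text \<open>Only used for \<open>n \<ge> 1\<close>.\<close>

definition bowen_dist :: "('a::metric_space \<Rightarrow> 'a) \<Rightarrow> nat \<Rightarrow> 'a \<Rightarrow> 'a \<Rightarrow> real" where
  "bowen_dist T n x y = Max ((\<lambda>j. dist ((T ^^ j) x) ((T ^^ j) y)) ` {0..<n})"

definition separated :: "nat \<Rightarrow> real \<Rightarrow> 'a set \<Rightarrow> ('a::metric_space \<Rightarrow> 'a) \<Rightarrow> 'a set \<Rightarrow> bool" where
  "separated n \<epsilon> K T E \<longleftrightarrow> E \<subseteq> K \<and> (\<forall>x\<in>E. \<forall>y\<in>E. x \<noteq> y \<longrightarrow> bowen_dist T n x y > \<epsilon>)"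

text \<open>
  Finiteness of \<open>E\<close> is demanded only because \<open>card\<close> is \<open>0\<close> on infinite sets; subsets of separated
  sets are separated, so an infinite separated set gives the value \<open>\<infinity>\<close>. On a subset \<open>K\<close> of a
  compact \<open>X\<close>, with \<open>T\<close> continuous on \<open>X\<close>, the supremum is a maximum.
\<close>

definition sep_number :: "nat \<Rightarrow> real \<Rightarrow> 'a set \<Rightarrow> ('a::metric_space \<Rightarrow> 'a) \<Rightarrow> enat" where
  "sep_number n \<epsilon> K T = (SUP E \<in> {E. finite E \<and> separated n \<epsilon> K T E}. enat (card E))"

text \<open>The set \<open>T\<^sup>-\<^sup>k(x)\<close>, taken inside \<open>X\<close>.\<close>

definition preimage_set :: "'a set \<Rightarrow> ('a \<Rightarrow> 'a) \<Rightarrow> nat \<Rightarrow> 'a \<Rightarrow> 'a set" where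
  "preimage_set X T k x = {y \<in> X. (T ^^ k) y = x}"

definition log_enat :: "enat \<Rightarrow> ereal" where
  "log_enat m = (case m of enat k \<Rightarrow> (if k = 0 then -\<infinity> else ereal (ln (real k))) | \<infinity> \<Rightarrow> \<infinity>)"

definition log_pre_sep :: "'a set \<Rightarrow> ('a::metric_space \<Rightarrow> 'a) \<Rightarrow> real \<Rightarrow> nat \<Rightarrow> ereal" where
  "log_pre_sep X T \<epsilon> n =
     log_enat (SUP x\<in>X. SUP k\<in>{n..}. sep_number n \<epsilon> (preimage_set X T k x) T)"

definition h_pre :: "'a set \<Rightarrow> ('a::metric_space \<Rightarrow> 'a) \<Rightarrow> ereal" where
  "h_pre X T = Lim (at_right 0) (\<lambda>\<epsilon>. limsup (\<lambda>n. log_pre_sep X T \<epsilon> n / ereal (real n)))"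

definition D_pre_s :: "'a set \<Rightarrow> real \<Rightarrow> ('a::metric_space \<Rightarrow> 'a) \<Rightarrow> ereal" where
  "D_pre_s X s T = Lim (at_right 0) (\<lambda>\<epsilon>. limsup (\<lambda>n. log_pre_sep X T \<epsilon> n / ereal (real n powr s)))"

text \<open>
  The infimum is taken in \<^typ>\<open>ereal\<close>, so it is \<open>\<infinity>\<close> for the empty set. It agrees with the supremum
  of the parameters where the value is \<open>\<infinity>\<close>: see \<open>D_pre_eq_Sup\<close> below.
\<close>

definition D_pre :: "'a set \<Rightarrow> ('a::metric_space \<Rightarrow> 'a) \<Rightarrow> ereal" where
  "D_pre X T = Inf {ereal s | s. s > 0 \<and> D_pre_s X s T = 0}"

subsection \<open>The limits exist, and the two descriptions of the dimension agree\<close>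

lemma tendsto_SUP_at_right_0:
  fixes f :: "real \<Rightarrow> ereal"
  assumes "\<And>a b. 0 < a \<Longrightarrow> a \<le> b \<Longrightarrow> f b \<le> f a"
  shows "(f \<longlongrightarrow> (SUP \<epsilon>\<in>{0<..}. f \<epsilon>)) (at_right 0)"
proof (rule increasing_tendsto)
  show "\<forall>\<^sub>F \<epsilon> in at_right 0. f \<epsilon> \<le> (SUP \<epsilon>\<in>{0<..}. f \<epsilon>)"
    by (auto intro!: eventually_at_rightI[of 0 1] SUP_upper)
  fix y assume "y < (SUP \<epsilon>\<in>{0<..}. f \<epsilon>)"
  then obtain b where b: "b > 0" "y < f b"
    by (auto simp: less_SUP_iff)
  show "\<forall>\<^sub>F \<epsilon> in at_right 0. y < f \<epsilon>"
    by (rule eventually_at_rightI[of 0 b]) (use b assms in \<open>auto intro: less_le_trans\<close>)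
qed

lemma log_enat_mono: "a \<le> b \<Longrightarrow> log_enat a \<le> log_enat b"
  by (auto simp: log_enat_def split: enat.splits)

lemma log_pre_sep_antimono: "a \<le> b \<Longrightarrow> log_pre_sep X T b n \<le> log_pre_sep X T a n"
  unfolding log_pre_sep_def sep_number_def
  by (intro log_enat_mono SUP_mono' SUP_subset_mono order_refl)
     (force simp: separated_def)

lemma limsup_log_pre_sep_tendsto:
  assumes "\<And>n. 0 \<le> c n"
  shows "((\<lambda>\<epsilon>. limsup (\<lambda>n. log_pre_sep X T \<epsilon> n / ereal (c n))) \<longlongrightarrow>
           (SUP \<epsilon>\<in>{0<..}. limsup (\<lambda>n. log_pre_sep X T \<epsilon> n / ereal (c n)))) (at_right 0)"
  by (rule tendsto_SUP_at_right_0, rule Limsup_mono, rule always_eventually)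
     (auto simp: divide_ereal_def assms intro!: ereal_mult_right_mono log_pre_sep_antimono
       simp del: inverse_ereal.simps intro: ereal_inverse_nonneg_iff[THEN iffD2])

lemma h_pre_eq_SUP:
  "h_pre X T = (SUP \<epsilon>\<in>{0<..}. limsup (\<lambda>n. log_pre_sep X T \<epsilon> n / ereal (real n)))"
  unfolding h_pre_def
  by (rule tendsto_Lim[OF trivial_limit_at_right_real limsup_log_pre_sep_tendsto]) simp

lemma D_pre_s_eq_SUP:
  "D_pre_s X s T = (SUP \<epsilon>\<in>{0<..}. limsup (\<lambda>n. log_pre_sep X T \<epsilon> n / ereal (real n powr s)))"
  unfolding D_pre_s_def
  by (rule tendsto_Lim[OF trivial_limit_at_right_real limsup_log_pre_sep_tendsto]) simp

lemma log_pre_sep_nonneg: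
  assumes "X \<noteq> {}" "T \<in> X \<rightarrow> X"
  shows "log_pre_sep X T \<epsilon> n \<ge> 0"
proof -
  obtain y where y: "y \<in> X" using assms by auto
  have "(T ^^ k) y \<in> X" for k
    by (induction k) (use y assms in auto)
  then have x: "(T ^^ n) y \<in> X" .
  have "enat (card {y}) \<le> sep_number n \<epsilon> (preimage_set X T n ((T ^^ n) y)) T"
    unfolding sep_number_def
    by (rule SUP_upper) (use y in \<open>auto simp: separated_def preimage_set_def\<close>)
  also have "\<dots> \<le> (SUP k\<in>{n..}. sep_number n \<epsilon> (preimage_set X T k ((T ^^ n) y)) T)"
    by (rule SUP_upper) auto
  also have "\<dots> \<le> (SUP x\<in>X. SUP k\<in>{n..}. sep_number n \<epsilon> (preimage_set X T k x) T)"
    by (rule SUP_upper[OF x])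
  finally show ?thesis
    unfolding log_pre_sep_def
    by (auto simp: log_enat_def one_enat_def split: enat.splits)
qed

lemma D_pre_s_eq_0:
  assumes "X \<noteq> {}" "T \<in> X \<rightarrow> X" "s < t" "D_pre_s X s T \<noteq> \<infinity>"
  shows "D_pre_s X t T = 0"
proof -
  have "limsup (\<lambda>n. log_pre_sep X T \<epsilon> n / ereal (real n powr t)) = 0" if "\<epsilon> > 0" for \<epsilon>
  proof (rule antisym)
    have "limsup (\<lambda>n. log_pre_sep X T \<epsilon> n / ereal (real n powr s)) \<le> D_pre_s X s T"
      unfolding D_pre_s_eq_SUP by (rule SUP_upper) (use that in auto)
    then have "limsup (\<lambda>n. log_pre_sep X T \<epsilon> n / ereal (real n powr s)) < \<infinity>"
      using assms(4) by auto
    then obtain C where C: "limsup (\<lambda>n. log_pre_sep X T \<epsilon> n / ereal (real n powr s)) < ereal C"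
      using less_PInf_Ex_of_nat by auto
    have ev: "\<forall>\<^sub>F n in sequentially. log_pre_sep X T \<epsilon> n / ereal (real n powr t) \<le> ereal (C * real n powr (s - t))"
      using Limsup_lessD[OF C] eventually_gt_at_top[of 0]
    proof eventually_elim
      case (elim n)
      show ?case
      proof (cases "log_pre_sep X T \<epsilon> n")
        case (real r)
        then show ?thesis using elim by (simp add: powr_diff field_simps)
      qed (use elim log_pre_sep_nonneg[OF assms(1,2), of \<epsilon> n] in auto)
    qed
    have "(\<lambda>n. C * real n powr (s - t)) \<longlonglongrightarrow> C * 0"
      by (intro tendsto_intros tendsto_neg_powr filterlim_real_sequentially) (use assms in auto)
    then have "limsup (\<lambda>n. ereal (C * real n powr (s - t))) = ereal 0"
      by (intro lim_imp_Limsup) auto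
    then show "limsup (\<lambda>n. log_pre_sep X T \<epsilon> n / ereal (real n powr t)) \<le> 0"
      using Limsup_mono[OF ev] by (simp add: zero_ereal_def)
    have "0 \<le> log_pre_sep X T \<epsilon> n / ereal (real n powr t)" for n
      unfolding divide_ereal_def
      by (intro ereal_0_le_mult log_pre_sep_nonneg assms ereal_inverse_nonneg_iff[THEN iffD2]) auto
    then show "0 \<le> limsup (\<lambda>n. log_pre_sep X T \<epsilon> n / ereal (real n powr t))"
      by (intro le_Limsup) auto
  qed
  then show ?thesis
    unfolding D_pre_s_eq_SUP by (intro SUP_eq_const) auto
qed

lemma D_pre_eq_Sup:
  assumes "X \<noteq> {}" "T \<in> X \<rightarrow> X"
  shows "D_pre X T = Sup (insert 0 {ereal s | s. s > 0 \<and> D_pre_s X s T = \<infinity>})" (is "_ = ?S")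
proof (rule antisym)
  show "?S \<le> D_pre X T"
    unfolding D_pre_def
  proof (intro Sup_least Inf_greatest)
    fix u v assume u: "u \<in> insert 0 {ereal s | s. s > 0 \<and> D_pre_s X s T = \<infinity>}"
      and v: "v \<in> {ereal s | s. s > 0 \<and> D_pre_s X s T = 0}"
    then obtain b where b: "v = ereal b" "b > 0" "D_pre_s X b T = 0" by auto
    show "u \<le> v"
    proof (cases "u = 0")
      case False
      with u obtain a where "u = ereal a" "D_pre_s X a T = \<infinity>" by auto
      with b D_pre_s_eq_0[OF assms, of b a] show ?thesis by force
    qed (use b in auto)
  qed
  show "D_pre X T \<le> ?S"
  proof (rule ccontr)
    assume "\<not> ?thesis"
    then have "?S < D_pre X T" by (rule not_le_imp_less)
    then obtain s where s: "?S < ereal s" "ereal s < D_pre X T" using ereal_dense2 by blast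
    then obtain t where t: "ereal s < ereal t" "ereal t < D_pre X T" using ereal_dense2 by blast
    have "0 \<le> ?S" by (rule Sup_upper) simp
    then have "ereal 0 < ereal s" using s by (simp add: zero_ereal_def order.strict_trans1)
    then have pos: "s > 0" by simp
    have "D_pre_s X s T \<noteq> \<infinity>"
    proof
      assume "D_pre_s X s T = \<infinity>"
      then have "ereal s \<le> ?S" by (intro Sup_upper) (use pos in auto)
      from leD[OF this] s(1) show False by (rule notE)
    qed
    with t have "D_pre_s X t T = 0" by (intro D_pre_s_eq_0[OF assms, of s]) auto
    then have "D_pre X T \<le> ereal t"
      unfolding D_pre_def by (intro Inf_lower) (use pos t in auto)
    with t show False by simp
  qed
qed

end

theory Submission
  imports Defs
begin

text \<open>
  Since \<^prop>\<open>h_pre X T = D_pre_s X 1 T\<close>, everything reduces to comparing the exponent 1 with the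
  value at which \<open>s \<mapsto> D_pre_s X s T\<close> drops from \<open>\<infinity>\<close> to 0.
\<close>

lemma h_pre_eq_D_pre_s_1: "h_pre X T = D_pre_s X 1 T"
  by (simp add: h_pre_def D_pre_s_def)

text \<open>Each \<open>t > s\<close> is positive and has \<open>D_pre_s X t T = 0\<close>, so it
  bounds the infimum; such \<open>t\<close> come arbitrarily close to \<open>s\<close>.\<close>

lemma D_pre_le:
  assumes "X \<noteq> {}" "T \<in> X \<rightarrow> X" "0 \<le> s" "D_pre_s X s T \<noteq> \<infinity>"
  shows "D_pre X T \<le> ereal s"
proof (rule dense_le)
  fix y assume "y < D_pre X T"
  show "y \<le> ereal s"
  proof (rule ccontr)
    assume "\<not> y \<le> ereal s"
    then obtain t where t: "ereal s < ereal t" "ereal t < y"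
      using ereal_dense2 not_le_imp_less by blast
    with assms have "t > 0" "D_pre_s X t T = 0"
      by (auto intro: D_pre_s_eq_0)
    then have "D_pre X T \<le> ereal t"
      unfolding D_pre_def by (intro Inf_lower) auto
    with t \<open>y < D_pre X T\<close> show False by simp
  qed
qed

text \<open>A zero at some \<open>t < s\<close> is a finite value, so it would force a zero at
  \<open>s\<close> as well.\<close>

lemma D_pre_ge:
  assumes "X \<noteq> {}" "T \<in> X \<rightarrow> X" "D_pre_s X s T \<noteq> 0"
  shows "ereal s \<le> D_pre X T"
  unfolding D_pre_def
proof (rule Inf_greatest, clarify)
  fix t assume t: "t > 0" "D_pre_s X t T = 0"
  show "ereal s \<le> ereal t"
    using D_pre_s_eq_0[OF assms(1,2), of t s] t assms(3) by force
qed

theorem theorem3p2: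
  fixes X :: "'a::metric_space set" and T :: "'a \<Rightarrow> 'a"
  assumes "compact X" and "X \<noteq> {}"
    and "T \<in> X \<rightarrow> X" and "continuous_on X T"
  shows "(h_pre X T < \<infinity> \<longrightarrow> D_pre X T \<le> 1) \<and>
         (h_pre X T = \<infinity> \<longrightarrow> D_pre X T \<ge> 1) \<and>
         (0 < h_pre X T \<and> h_pre X T < \<infinity> \<longrightarrow> D_pre X T = 1)"
proof -
  have "D_pre X T \<le> 1" if "h_pre X T < \<infinity>"
    using D_pre_le[OF assms(2,3), of 1] that by (simp add: h_pre_eq_D_pre_s_1 one_ereal_def)
  \<comment> \<open>Assuming only positivity covers the infinite case and the lower half of the
    equality case at once.\<close>
  moreover have "D_pre X T \<ge> 1" if "0 < h_pre X T"
    using D_pre_ge[OF assms(2,3), of 1] that by (simp add: h_pre_eq_D_pre_s_1 one_ereal_def)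
  ultimately show ?thesis
    by (auto intro: antisym)
qed

end
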